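(* Let $S=\{1,\ldots,s\}$ and let $(A_n)_{n\ge 0}$ be a chain of $s\times s$ row stochastic matrices that is an $l_1$-approximation of a balanced asymmetric chain. Let $X(n)=[X_1(n)\cdots X_s(n)]^T\in\mathbb{R}^s$, $n\ge 0$, evolve according to $X(n+1)=A_nX(n)$ for all $n\ge 0$, from an arbitrary initial state $X(0)\in\mathbb{R}^s$. For each $n\ge 0$ and $i\in S$ let $z_i(n)$ denote the $i$th least number among $X_1(n),\ldots,X_s(n)$ (counted with multiplicity, so that $z_1(n)\le z_2(n)\le\cdots\le z_s(n)$ is the nondecreasing rearrangement of the components of $X(n)$). Then $\lim_{n\to\infty}z_i(n)$ exists for every $i\in S$.
   Context: A matrix is (row) stochastic if its entries are nonnegative real numbers and each row sums to 1. A chain is a sequence of matrices indexed by $n\ge 0$; the entries of $A_n$ are written $a_{ij}(n)$. $l_1$-approximation: a chain $(A_n)$ of stochastic matrices is an $l_1$-approximation of a chain $(B_n)$ of stochastic matrices of the same order if $\sum_{n=0}^{\infty}\|A_n-B_n\|<\infty$, where $\|\cdot\|$ is the max norm (maximum of the absolute values of the entries). Balanced asymmetry: a chain $(B_n)$ of stochastic matrices with entries $b_{ij}(n)$ is balanced asymmetric if there exists $M\ge 1$ such that for any two nonempty subsets $S_1,S_2$ of $S=\{1,\ldots,s\}$ with the same cardinality, $$\sum_{i\in S_1}\sum_{j\in\bar S_2}b_{ij}(n)\le M\sum_{i\in\bar S_1}\sum_{j\in S_2}b_{ij}(n)\quad\text{for all } n\ge 0,$$ where the overbar denotes complementation in $S$.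 *)

theory Defs
  imports "HOL-Analysis.Analysis" "HOL-Library.Multiset"
begin

text \<open>
  The index set \<open>S = {1, ..., s}\<close> is rendered as a finite type \<open>'n\<close>, with
  \<open>s = CARD('n)\<close>; only the ranks of the order statistics need to be numbers.
\<close>

definition row_stochastic :: "real ^ 'n ^ 'n \<Rightarrow> bool" where
  "row_stochastic A \<longleftrightarrow>
     (\<forall>i j. 0 \<le> A $ i $ j) \<and> (\<forall>i. (\<Sum>j\<in>UNIV. A $ i $ j) = 1)"

definition stochastic_chain :: "(nat \<Rightarrow> real ^ 'n ^ 'n) \<Rightarrow> bool" where
  "stochastic_chain A \<longleftrightarrow> (\<forall>n. row_stochastic (A n))"

definition mat_max_norm :: "real ^ 'n ^ 'm \<Rightarrow> real" where
  "mat_max_norm A = Max {\<bar>A $ i $ j\<bar> | i j. True}"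

definition l1_approximation ::
    "(nat \<Rightarrow> real ^ 'n ^ 'n) \<Rightarrow> (nat \<Rightarrow> real ^ 'n ^ 'n) \<Rightarrow> bool" where
  "l1_approximation A B \<longleftrightarrow>
     stochastic_chain A \<and> stochastic_chain B \<and>
     summable (\<lambda>n. mat_max_norm (A n - B n))"

definition balanced_asymmetric :: "(nat \<Rightarrow> real ^ 'n ^ 'n) \<Rightarrow> bool" where
  "balanced_asymmetric B \<longleftrightarrow>
     stochastic_chain B \<and>
     (\<exists>M::real. M \<ge> 1 \<and>
        (\<forall>S1 S2 :: 'n set. S1 \<noteq> {} \<and> S2 \<noteq> {} \<and> card S1 = card S2 \<longrightarrow>
           (\<forall>n. (\<Sum>i\<in>S1. \<Sum>j\<in>- S2. B n $ i $ j)
                  \<le> M * (\<Sum>i\<in>- S1. \<Sum>j\<in>S2. B n $ i $ j))))"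

text \<open>
  The \<open>k\<close>-th least component of \<open>x\<close>, counted with multiplicity. Ranks start at 1
  (lists are indexed from 0), so this is meaningful for \<open>1 \<le> k \<le> CARD('n)\<close>.
\<close>

definition kth_least :: "nat \<Rightarrow> real ^ 'n \<Rightarrow> real" where
  "kth_least k x =
     sorted_list_of_multiset (image_mset (\<lambda>i. x $ i) (mset_set UNIV)) ! (k - 1)"

end

theory Submission
  imports Defs
begin

text \<open>
  Let \<open>M\<close> be the constant of the balanced asymmetric chain \<open>B\<close>, let \<open>s\<close> be the number of
  components, and let \<open>z\<^sub>1(n) \<le> \<dots> \<le> z\<^sub>s(n)\<close> be the order statistics of \<open>X(n)\<close>. The idea is to
  use \<open>s\<close> Lyapunov functions at once, namely the truncated geometric sums
  \<open>\<Phi>\<^sub>m(n) = z\<^sub>1(n) + M\<^sup>-\<^sup>1 z\<^sub>2(n) + \<dots> + M\<^sup>-\<^sup>(\<^sup>m\<^sup>-\<^sup>1\<^sup>) z\<^sub>m(n)\<close> for \<open>m \<le> s\<close>.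

  If \<open>X\<close> evolved by \<open>B\<close> itself, every \<open>\<Phi>\<^sub>m\<close> would be nondecreasing. To see this, number
  the components by rank, with one numbering at time \<open>n\<close> and another one at time \<open>n + 1\<close>,
  and write the increment of \<open>\<Phi>\<^sub>m\<close> as a linear function of the ordered values at time \<open>n\<close>.
  Summation by parts expresses it through the gaps \<open>z\<^sub>k\<^sub>+\<^sub>1(n) - z\<^sub>k(n) \<ge> 0\<close>. The coefficient
  of the \<open>k\<close>-th gap compares the weighted flow across a cut: what the \<open>k\<close> lowest ranks receive
  from above raises \<open>\<Phi>\<^sub>m\<close>, what the other ranks receive from below lowers it.
  Balanced asymmetry says that the second flow is at most \<open>M\<close> times the first, and
  the weight drops by at least the factor \<open>M\<close> across the cut, so the coefficient is nonnegative
  (lemma \<open>cut_balance_prefix_sum_nonpos\<close>). Setting the weights beyond rank \<open>m\<close> to zero only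
  makes the drop larger, which is why the truncated sums are monotone too. The two subsets in
  the definition of balanced asymmetry are needed separately because the two numberings differ.

  Replacing \<open>B\<close> by \<open>A\<close> changes \<open>\<Phi>\<^sub>m(n + 1)\<close> by at most a constant times
  \<open>\<parallel>A\<^sub>n - B\<^sub>n\<parallel>\<close>, because \<open>X\<close> stays bounded. These errors are summable, so the bounded sequence
  \<open>\<Phi>\<^sub>m\<close>, nondecreasing up to them, converges (lemma \<open>convergent_if_almost_increasing\<close>).
  Finally \<open>\<Phi>\<^sub>m\<^sub>+\<^sub>1 - \<Phi>\<^sub>m\<close> is a nonzero multiple of \<open>z\<^sub>m\<^sub>+\<^sub>1\<close>.
\<close>

section \<open>Sequences that increase up to a summable error\<close>

text \<open>Adding the partial sums of the errors turns the sequence into a monotone one.\<close>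

lemma convergent_if_almost_increasing:
  fixes a e :: "nat \<Rightarrow> real"
  assumes step: "\<And>n. a n \<le> a (Suc n) + e n"
    and sum_e: "summable e"
    and bound: "\<And>n. \<bar>a n\<bar> \<le> C"
  shows "convergent a"
proof -
  define b where "b n = a n + (\<Sum>i<n. e i)" for n
  have conv_e: "convergent (\<lambda>n. \<Sum>i<n. e i)"
    using sum_e by (simp add: summable_iff_convergent)
  then obtain K where K: "\<And>n. \<bar>\<Sum>i<n. e i\<bar> \<le> K"
    using convergent_imp_Bseq Bseq_def by (metis real_norm_def)
  have "\<bar>b n\<bar> \<le> C + K" for n
    using bound[of n] K[of n] by (simp add: b_def)
  hence "Bseq b" by (intro BseqI'[of _ "C + K"]) simp
  moreover have "incseq b"
    using step by (intro incseq_SucI) (simp add: b_def algebra_simps)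
  ultimately have "convergent b"
    by (intro Bseq_mono_convergent) (auto simp: incseq_def)
  hence "convergent (\<lambda>n. b n - (\<Sum>i<n. e i))"
    using conv_e by (intro convergent_diff)
  thus ?thesis by (simp add: b_def)
qed

section \<open>Weighted sums under a stochastic matrix with balanced cuts\<close>

text \<open>
  Summation by parts: the right side minus the left side is the sum over \<open>k < n\<close> of
  \<open>-(y (Suc k) - y k)\<close> times the prefix sum \<open>\<Sum>j\<le>k. v j\<close>.
\<close>

lemma sum_mult_mono_ge_if_prefix_sums_nonpos:
  fixes v y :: "nat \<Rightarrow> real"
  assumes "\<And>k. k < n \<Longrightarrow> (\<Sum>j\<le>k. v j) \<le> 0"
    and "\<And>k. k < n \<Longrightarrow> y k \<le> y (Suc k)"
  shows "y n * (\<Sum>j\<le>n. v j) \<le> (\<Sum>j\<le>n. v j * y j)"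
  using assms
proof (induction n)
  case (Suc n)
  have "y (Suc n) * (\<Sum>j\<le>n. v j) \<le> y n * (\<Sum>j\<le>n. v j)"
    using Suc.prems by (intro mult_right_mono_neg) auto
  also have "\<dots> \<le> (\<Sum>j\<le>n. v j * y j)"
    using Suc by auto
  finally show ?case by (simp add: algebra_simps)
qed simp

text \<open>
  The flow estimate across the cut between the indices below \<open>k\<close> and the others. Each
  index \<open>i \<ge> k\<close> has weight at most \<open>w k\<close>, each \<open>i < k\<close> has weight at least \<open>M * w k\<close>, and this
  factor \<open>M\<close> is exactly what the cut hypothesis can lose.
\<close>

lemma cut_balance_prefix_sum_nonpos:
  fixes c :: "nat \<Rightarrow> nat \<Rightarrow> real" and w :: "nat \<Rightarrow> real"
  assumes nonneg: "\<And>i j. 0 \<le> c i j"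
    and row: "\<And>i. i < s \<Longrightarrow> (\<Sum>j<s. c i j) = 1"
    and cut: "(\<Sum>i=k..<s. \<Sum>j<k. c i j) \<le> M * (\<Sum>i<k. \<Sum>j=k..<s. c i j)"
    and M: "M \<ge> 1"
    and w_nonneg: "\<And>i. 0 \<le> w i"
    and w_drop: "\<And>i j. i < j \<Longrightarrow> M * w j \<le> w i"
    and k: "k \<le> s"
  shows "(\<Sum>j<k. (\<Sum>i<s. w i * c i j) - w j) \<le> 0"
proof -
  define below where "below i = (\<Sum>j<k. c i j)" for i
  define above where "above i = (\<Sum>j=k..<s. c i j)" for i
  have split: "sum f {..<s} = sum f {..<k} + sum f {k..<s}" for f :: "nat \<Rightarrow> real"
    using k by (metis ivl_disj_int_one(2) ivl_disj_un_one(2) finite_lessThan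
        finite_atLeastLessThan sum.union_disjoint)
  have below_above: "below i = 1 - above i" if "i < s" for i
    using row[OF that] split[of "c i"] by (simp add: below_def above_def)
  have w_mono: "w i \<le> w k" if "k \<le> i" for i
  proof (cases "i = k")
    case False
    have "w i \<le> M * w i" using M w_nonneg[of i] by (simp add: mult_le_cancel_right1)
    also have "\<dots> \<le> w k" using that False by (intro w_drop) auto
    finally show ?thesis .
  qed simp
  have "(\<Sum>i=k..<s. w i * below i) \<le> (\<Sum>i=k..<s. w k * below i)"
    by (intro sum_mono mult_right_mono) (auto simp: below_def w_mono intro: sum_nonneg nonneg)
  also have "\<dots> = w k * (\<Sum>i=k..<s. below i)"
    by (simp add: sum_distrib_left)
  also have "\<dots> \<le> w k * (M * (\<Sum>i<k. above i))"
    using cut w_nonneg by (intro mult_left_mono) (auto simp: below_def above_def)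
  also have "\<dots> = (\<Sum>i<k. (M * w k) * above i)"
    by (simp add: sum_distrib_left mult_ac)
  also have "\<dots> \<le> (\<Sum>i<k. w i * above i)"
    by (intro sum_mono mult_right_mono) (auto simp: above_def w_drop intro: sum_nonneg nonneg)
  finally have flow: "(\<Sum>i=k..<s. w i * below i) \<le> (\<Sum>i<k. w i * above i)" .
  have "(\<Sum>j<k. (\<Sum>i<s. w i * c i j) - w j) = (\<Sum>i<s. w i * below i) - (\<Sum>j<k. w j)"
    unfolding below_def sum_subtractf sum_distrib_left by (subst sum.swap) simp
  also have "\<dots> = (\<Sum>i<k. w i * below i) + (\<Sum>i=k..<s. w i * below i) - (\<Sum>j<k. w j)"
    by (simp add: split)
  also have "(\<Sum>i<k. w i * below i) = (\<Sum>j<k. w j) - (\<Sum>i<k. w i * above i)"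
    using k by (simp add: below_above algebra_simps flip: sum_subtractf)
  finally show ?thesis using flow by simp
qed

lemma weighted_sum_le_stochastic_image:
  fixes c :: "nat \<Rightarrow> nat \<Rightarrow> real" and w y :: "nat \<Rightarrow> real"
  assumes nonneg: "\<And>i j. 0 \<le> c i j"
    and row: "\<And>i. i < s \<Longrightarrow> (\<Sum>j<s. c i j) = 1"
    and cut: "\<And>k. k \<le> s \<Longrightarrow>
                (\<Sum>i=k..<s. \<Sum>j<k. c i j) \<le> M * (\<Sum>i<k. \<Sum>j=k..<s. c i j)"
    and M: "M \<ge> 1"
    and w_nonneg: "\<And>i. 0 \<le> w i"
    and w_drop: "\<And>i j. i < j \<Longrightarrow> M * w j \<le> w i"
    and y_mono: "\<And>i. Suc i < s \<Longrightarrow> y i \<le> y (Suc i)"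
  shows "(\<Sum>i<s. w i * y i) \<le> (\<Sum>i<s. w i * (\<Sum>j<s. c i j * y j))"
proof (cases s)
  case (Suc n)
  define v where "v j = (\<Sum>i<s. w i * c i j) - w j" for j
  have prefix: "(\<Sum>j\<le>k. v j) \<le> 0" if "k < s" for k
    unfolding v_def lessThan_Suc_atMost[symmetric] using that
    by (intro cut_balance_prefix_sum_nonpos[OF nonneg row cut M w_nonneg w_drop]) simp_all
  have "(\<Sum>j<s. v j) = (\<Sum>i<s. w i * (\<Sum>j<s. c i j)) - (\<Sum>i<s. w i)"
    unfolding v_def sum_subtractf sum_distrib_left by (subst sum.swap) simp
  hence "(\<Sum>j<s. v j) = 0"
    by (simp add: row)
  hence total: "(\<Sum>j\<le>n. v j) = 0"
    unfolding Suc lessThan_Suc_atMost .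
  have "0 \<le> (\<Sum>j\<le>n. v j * y j)"
    using sum_mult_mono_ge_if_prefix_sums_nonpos[of n v y] prefix y_mono total
    by (simp add: Suc)
  also have "\<dots> = (\<Sum>j<s. (\<Sum>i<s. w i * c i j) * y j) - (\<Sum>j<s. w j * y j)"
    by (simp add: v_def Suc lessThan_Suc_atMost left_diff_distrib sum_subtractf)
  also have "(\<Sum>j<s. (\<Sum>i<s. w i * c i j) * y j) = (\<Sum>i<s. w i * (\<Sum>j<s. c i j * y j))"
    unfolding sum_distrib_left sum_distrib_right by (subst sum.swap) (simp add: mult_ac)
  finally show ?thesis by simp
qed simp

section \<open>Order statistics\<close>

lemma rank_numbering:
  fixes x :: "real ^ 'n"
  obtains \<sigma> :: "nat \<Rightarrow> 'n"
  where "bij_betw \<sigma> {..<CARD('n)} UNIV"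
    and "\<And>i. i < CARD('n) \<Longrightarrow> kth_least (Suc i) x = x $ \<sigma> i"
    and "\<And>i j. i \<le> j \<Longrightarrow> j < CARD('n) \<Longrightarrow> x $ \<sigma> i \<le> x $ \<sigma> j"
proof -
  obtain us :: "'n list" where us: "set us = UNIV" "distinct us"
    using finite_distinct_list[of "UNIV :: 'n set"] by auto
  define vs where "vs = sort_key (\<lambda>i. x $ i) us"
  have vs: "set vs = UNIV" "distinct vs" "sorted (map (\<lambda>i. x $ i) vs)"
    using us by (auto simp: vs_def)
  have len: "length vs = CARD('n)"
    using distinct_card[OF vs(2)] vs(1) by simp
  have "image_mset (\<lambda>i. x $ i) (mset_set UNIV) = mset (map (\<lambda>i. x $ i) vs)"
    using mset_set_set[OF vs(2)] vs(1) by simp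
  hence list: "sorted_list_of_multiset (image_mset (\<lambda>i. x $ i) (mset_set UNIV))
      = map (\<lambda>i. x $ i) vs"
    using vs(3) by (simp only: sorted_list_of_multiset_mset sorted_sort_id)
  show thesis
  proof (rule that[of "\<lambda>i. vs ! i"])
    show "bij_betw (\<lambda>i. vs ! i) {..<CARD('n)} UNIV"
      using vs len by (intro bij_betw_nth) auto
    show "kth_least (Suc i) x = x $ (vs ! i)" if "i < CARD('n)" for i
      using that by (simp add: kth_least_def list len)
    show "x $ (vs ! i) \<le> x $ (vs ! j)" if "i \<le> j" "j < CARD('n)" for i j
      using sorted_nth_mono[OF vs(3), of i j] that by (simp add: len)
  qed
qed

lemma abs_kth_least_le:
  fixes x :: "real ^ 'n"
  assumes "i < CARD('n)" and "\<And>j. \<bar>x $ j\<bar> \<le> C"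
  shows "\<bar>kth_least (Suc i) x\<bar> \<le> C"
proof -
  obtain \<sigma> :: "nat \<Rightarrow> 'n" where "\<And>i. i < CARD('n) \<Longrightarrow> kth_least (Suc i) x = x $ \<sigma> i"
    using rank_numbering[of x] by metis
  thus ?thesis using assms by simp
qed

text \<open>
  The numbering \<open>\<sigma>\<close> of the rows is arbitrary so that it can later be the ranking of the state
  computed with the perturbed matrix \<open>A\<close>, although the matrix here is \<open>B\<close>. This is possible
  because summation by parts asks only the old values to be ordered, while balanced asymmetry
  holds for every pair of subsets of equal size and thus for the cuts of every \<open>\<sigma>\<close>.
\<close>

lemma geometric_rank_sum_le:
  fixes B :: "real ^ 'n ^ 'n" and x :: "real ^ 'n" and \<sigma> :: "nat \<Rightarrow> 'n"
  assumes B: "row_stochastic B"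
    and M: "M \<ge> 1"
    and cut: "\<And>S1 S2 :: 'n set. S1 \<noteq> {} \<Longrightarrow> S2 \<noteq> {} \<Longrightarrow> card S1 = card S2 \<Longrightarrow>
        (\<Sum>i\<in>S1. \<Sum>j\<in>- S2. B $ i $ j) \<le> M * (\<Sum>i\<in>- S1. \<Sum>j\<in>S2. B $ i $ j)"
    and \<sigma>: "bij_betw \<sigma> {..<CARD('n)} UNIV"
    and m: "m \<le> CARD('n)"
  shows "(\<Sum>i<m. (1 / M) ^ i * kth_least (Suc i) x) \<le> (\<Sum>i<m. (1 / M) ^ i * (B *v x) $ \<sigma> i)"
proof -
  obtain \<tau> :: "nat \<Rightarrow> 'n" where \<tau>: "bij_betw \<tau> {..<CARD('n)} UNIV"
    and rank: "\<And>i. i < CARD('n) \<Longrightarrow> kth_least (Suc i) x = x $ \<tau> i"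
    and sorted: "\<And>i j. i \<le> j \<Longrightarrow> j < CARD('n) \<Longrightarrow> x $ \<tau> i \<le> x $ \<tau> j"
    using rank_numbering[of x] by metis
  define s where "s = CARD('n)"
  define w where "w i = (if i < m then (1 / M) ^ i else 0)" for i
  define c where "c i j = B $ \<sigma> i $ \<tau> j" for i j
  have truncate: "(\<Sum>i<s. w i * f i) = (\<Sum>i<m. (1 / M) ^ i * f i)" for f :: "nat \<Rightarrow> real"
    using m by (intro sum.mono_neutral_cong_right) (auto simp: w_def s_def)
  have inj: "inj_on \<rho> I" and compl: "- \<rho> ` {..<k} = \<rho> ` {k..<s}"
    if \<rho>: "bij_betw \<rho> {..<s} UNIV" and "I \<subseteq> {..<s}" and "k \<le> s"
    for \<rho> :: "nat \<Rightarrow> 'n" and I k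
  proof -
    show "inj_on \<rho> I"
      using that bij_betw_imp_inj_on inj_on_subset by blast
    have "\<rho> ` ({..<s} - {..<k}) = \<rho> ` {..<s} - \<rho> ` {..<k}"
      using \<rho> \<open>k \<le> s\<close> by (intro inj_on_image_set_diff[of _ "{..<s}"]) (auto simp: bij_betw_def)
    moreover have "{..<s} - {..<k} = {k..<s}" by auto
    ultimately show "- \<rho> ` {..<k} = \<rho> ` {k..<s}"
      using \<rho> by (simp add: bij_betw_def Compl_eq_Diff_UNIV)
  qed
  have bij: "bij_betw \<sigma> {..<s} UNIV" "bij_betw \<tau> {..<s} UNIV"
    using \<sigma> \<tau> by (simp_all add: s_def)
  have reindex: "(\<Sum>i\<in>\<sigma> ` I. \<Sum>j\<in>\<tau> ` J. B $ i $ j) = (\<Sum>i\<in>I. \<Sum>j\<in>J. c i j)"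
    if "I \<subseteq> {..<s}" "J \<subseteq> {..<s}" for I J
    using that inj[OF bij(1), of I 0] inj[OF bij(2), of J 0]
    by (simp add: sum.reindex c_def)
  have cut': "(\<Sum>i=k..<s. \<Sum>j<k. c i j) \<le> M * (\<Sum>i<k. \<Sum>j=k..<s. c i j)" if "k \<le> s" for k
  proof (cases "k = s")
    case False
    \<comment> \<open>Take the high ranks for both subsets. They are empty for \<open>k = s\<close>,
      where both flows vanish.\<close>
    have "card (\<sigma> ` {k..<s}) = card (\<tau> ` {k..<s})"
      using inj[OF bij(1), of "{k..<s}" k] inj[OF bij(2), of "{k..<s}" k] that
      by (simp add: card_image subset_eq)
    hence "(\<Sum>i\<in>\<sigma> ` {k..<s}. \<Sum>j\<in>- \<tau> ` {k..<s}. B $ i $ j)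
        \<le> M * (\<Sum>i\<in>- \<sigma> ` {k..<s}. \<Sum>j\<in>\<tau> ` {k..<s}. B $ i $ j)"
      using that False by (intro cut) auto
    moreover have "- \<sigma> ` {k..<s} = \<sigma> ` {..<k}" "- \<tau> ` {k..<s} = \<tau> ` {..<k}"
      using compl[OF bij(1) subset_refl that] compl[OF bij(2) subset_refl that]
      by (metis double_complement)+
    ultimately show ?thesis
      using that by (simp add: reindex subset_eq)
  qed simp
  have drop: "M * w j \<le> w i" if "i < j" for i j
  proof (cases "j < m")
    case True
    have "M * w j = (1 / M) ^ (j - 1)"
      using True that M by (cases j) (auto simp: w_def)
    also have "\<dots> \<le> (1 / M) ^ i"
      using that M by (intro power_decreasing) auto
    finally show ?thesis using True that by (simp add: w_def)
  qed (use M in \<open>simp add: w_def\<close>)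
  have row_sum: "(\<Sum>j<s. c i j * f (\<tau> j)) = (\<Sum>j\<in>UNIV. B $ \<sigma> i $ j * f j)" for i f
    unfolding c_def using sum.reindex_bij_betw[OF bij(2), of "\<lambda>j. B $ \<sigma> i $ j * f j"] .
  have "(\<Sum>i<s. w i * x $ \<tau> i) \<le> (\<Sum>i<s. w i * (\<Sum>j<s. c i j * x $ \<tau> j))"
  proof (rule weighted_sum_le_stochastic_image[OF _ _ cut' M _ drop])
    show "0 \<le> c i j" for i j
      using B by (simp add: row_stochastic_def c_def)
    show "(\<Sum>j<s. c i j) = 1" for i
      using B row_sum[of i "\<lambda>_. 1"] by (simp add: row_stochastic_def)
    show "0 \<le> w i" for i
      using M by (simp add: w_def)
    show "x $ \<tau> i \<le> x $ \<tau> (Suc i)" if "Suc i < s" for i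
      using that by (intro sorted) (auto simp: s_def)
  qed
  also have "(\<lambda>i. \<Sum>j<s. c i j * x $ \<tau> j) = (\<lambda>i. (B *v x) $ \<sigma> i)"
    by (simp add: row_sum matrix_vector_mult_def)
  finally show ?thesis
    using m by (simp add: truncate rank)
qed

section \<open>Bounds for the state and for the perturbation\<close>

lemma abs_entry_le_mat_max_norm: "\<bar>A $ i $ j\<bar> \<le> mat_max_norm A"
proof -
  have "{\<bar>A $ i $ j\<bar> | i j. True} = (\<lambda>(i, j). \<bar>A $ i $ j\<bar>) ` UNIV" by auto
  thus ?thesis unfolding mat_max_norm_def by (intro Max_ge) auto
qed

lemma abs_matrix_vector_mult_le:
  fixes A :: "real ^ 'n ^ 'm"
  assumes "\<And>j. \<bar>x $ j\<bar> \<le> C"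
  shows "\<bar>(A *v x) $ i\<bar> \<le> (\<Sum>j\<in>UNIV. \<bar>A $ i $ j\<bar>) * C"
proof -
  have "\<bar>(A *v x) $ i\<bar> \<le> (\<Sum>j\<in>UNIV. \<bar>A $ i $ j * x $ j\<bar>)"
    unfolding matrix_vector_mult_def by (simp add: sum_abs)
  also have "\<dots> \<le> (\<Sum>j\<in>UNIV. \<bar>A $ i $ j\<bar> * C)"
    using assms by (intro sum_mono) (auto simp: abs_mult intro: mult_left_mono)
  finally show ?thesis by (simp add: sum_distrib_right)
qed

lemma stochastic_evolution_bounded:
  fixes X :: "nat \<Rightarrow> real ^ 'n"
  assumes "stochastic_chain A" and "\<And>n. X (Suc n) = A n *v X n"
  obtains C where "\<And>n i. \<bar>X n $ i\<bar> \<le> C"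
proof
  show "\<bar>X n $ i\<bar> \<le> norm (X 0)" for n i
  proof (induction n arbitrary: i)
    case (Suc n)
    have "(\<Sum>j\<in>UNIV. \<bar>A n $ i $ j\<bar>) = 1"
      using assms(1) by (simp add: stochastic_chain_def row_stochastic_def)
    thus ?case
      using abs_matrix_vector_mult_le[OF Suc.IH, of "A n" i] by (simp add: assms(2))
  qed (rule component_le_norm_cart)
qed

section \<open>Convergence of the order statistics\<close>

text \<open>
  In the proof the new state is split as \<open>B *v x + (A - B) *v x\<close> and ranked by
  its own numbering. Every weight is at most 1, so each of the \<open>m\<close> terms of the sum
  loses at most the maximum norm of \<open>A - B\<close> times \<open>CARD('n) * C\<close>.
\<close>

lemma perturbed_geometric_rank_sum_le:
  fixes A B :: "real ^ 'n ^ 'n" and x :: "real ^ 'n"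
  assumes B: "row_stochastic B"
    and M: "M \<ge> 1"
    and cut: "\<And>S1 S2 :: 'n set. S1 \<noteq> {} \<Longrightarrow> S2 \<noteq> {} \<Longrightarrow> card S1 = card S2 \<Longrightarrow>
        (\<Sum>i\<in>S1. \<Sum>j\<in>- S2. B $ i $ j) \<le> M * (\<Sum>i\<in>- S1. \<Sum>j\<in>S2. B $ i $ j)"
    and C: "\<And>j. \<bar>x $ j\<bar> \<le> C"
    and m: "m \<le> CARD('n)"
  shows "(\<Sum>i<m. (1 / M) ^ i * kth_least (Suc i) x)
    \<le> (\<Sum>i<m. (1 / M) ^ i * kth_least (Suc i) (A *v x))
        + real m * real CARD('n) * C * mat_max_norm (A - B)"
proof -
  define err where "err = real CARD('n) * C * mat_max_norm (A - B)"
  obtain \<sigma> :: "nat \<Rightarrow> 'n" where \<sigma>: "bij_betw \<sigma> {..<CARD('n)} UNIV"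
    and rank: "\<And>i. i < CARD('n) \<Longrightarrow> kth_least (Suc i) (A *v x) = (A *v x) $ \<sigma> i"
    using rank_numbering[of "A *v x"] by metis
  \<comment> \<open>Any index serves here, because index types are nonempty.\<close>
  have C_nonneg: "0 \<le> C" using C[of undefined] by linarith
  have diff: "\<bar>((A - B) *v x) $ l\<bar> \<le> err" for l
  proof -
    have "(\<Sum>j\<in>UNIV. \<bar>(A - B) $ l $ j\<bar>) \<le> real CARD('n) * mat_max_norm (A - B)"
      by (intro sum_bounded_above abs_entry_le_mat_max_norm)
    hence "(\<Sum>j\<in>UNIV. \<bar>(A - B) $ l $ j\<bar>) * C \<le> real CARD('n) * mat_max_norm (A - B) * C"
      using C_nonneg by (rule mult_right_mono)
    thus ?thesis
      using abs_matrix_vector_mult_le[OF C, of "A - B" l] by (simp add: err_def mult_ac)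
  qed
  hence err_nonneg: "0 \<le> err"
    using abs_ge_zero order_trans by blast
  have comp: "(B *v x) $ l \<le> (A *v x) $ l + err" for l
    using diff[of l] by (simp add: matrix_vector_mult_diff_rdistrib abs_le_iff)
  have "(\<Sum>i<m. (1 / M) ^ i * kth_least (Suc i) x) \<le> (\<Sum>i<m. (1 / M) ^ i * (B *v x) $ \<sigma> i)"
    by (rule geometric_rank_sum_le[OF B M cut \<sigma> m])
  also have "\<dots> \<le> (\<Sum>i<m. (1 / M) ^ i * (A *v x) $ \<sigma> i + err)"
  proof (rule sum_mono)
    fix i
    have "(1 / M) ^ i * (B *v x) $ \<sigma> i \<le> (1 / M) ^ i * ((A *v x) $ \<sigma> i + err)"
      using M comp by (intro mult_left_mono) auto
    moreover have "(1 / M) ^ i * err \<le> err"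
      using M err_nonneg by (intro mult_left_le_one_le power_le_one) auto
    ultimately show "(1 / M) ^ i * (B *v x) $ \<sigma> i \<le> (1 / M) ^ i * (A *v x) $ \<sigma> i + err"
      by (simp add: distrib_left)
  qed
  also have "\<dots> = (\<Sum>i<m. (1 / M) ^ i * kth_least (Suc i) (A *v x)) + real m * err"
    using m by (simp add: sum.distrib rank)
  finally show ?thesis by (simp add: err_def mult_ac)
qed

theorem theorem1:
  fixes A B :: "nat \<Rightarrow> real ^ 'n ^ 'n"
    and X :: "nat \<Rightarrow> real ^ 'n"
  assumes "balanced_asymmetric B"
    and "l1_approximation A B"
    and "\<And>n. X (Suc n) = A n *v X n"
  shows "\<forall>k\<in>{1..CARD('n)}. convergent (\<lambda>n. kth_least k (X n))"
proof
  fix k assume k: "k \<in> {1..CARD('n)}"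
  have A: "stochastic_chain A" and B: "\<And>n. row_stochastic (B n)"
    and summable: "summable (\<lambda>n. mat_max_norm (A n - B n))"
    using assms(2) by (auto simp: l1_approximation_def stochastic_chain_def)
  obtain M :: real where M: "M \<ge> 1"
    and cut: "\<And>(S1 :: 'n set) S2 n. S1 \<noteq> {} \<Longrightarrow> S2 \<noteq> {} \<Longrightarrow> card S1 = card S2 \<Longrightarrow>
        (\<Sum>i\<in>S1. \<Sum>j\<in>- S2. B n $ i $ j) \<le> M * (\<Sum>i\<in>- S1. \<Sum>j\<in>S2. B n $ i $ j)"
    using assms(1) by (auto simp: balanced_asymmetric_def)
  obtain C where C: "\<And>n i. \<bar>X n $ i\<bar> \<le> C"
    using stochastic_evolution_bounded[OF A assms(3)] by blast
  define \<Phi> where "\<Phi> m n = (\<Sum>i<m. (1 / M) ^ i * kth_least (Suc i) (X n))" for m n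
  have \<Phi>_conv: "convergent (\<Phi> m)" if m: "m \<le> CARD('n)" for m
  proof (rule convergent_if_almost_increasing)
    show "\<Phi> m n \<le> \<Phi> m (Suc n) + real m * real CARD('n) * C * mat_max_norm (A n - B n)" for n
      unfolding \<Phi>_def assms(3) by (rule perturbed_geometric_rank_sum_le[OF B M cut C m])
    show "summable (\<lambda>n. real m * real CARD('n) * C * mat_max_norm (A n - B n))"
      using summable by (rule summable_mult)
    show "\<bar>\<Phi> m n\<bar> \<le> (\<Sum>i<m. (1 / M) ^ i * C)" for n
      unfolding \<Phi>_def
    proof (rule order_trans[OF sum_abs sum_mono])
      fix i assume "i \<in> {..<m}"
      hence "\<bar>kth_least (Suc i) (X n)\<bar> \<le> C"
        using m C by (intro abs_kth_least_le) auto
      thus "\<bar>(1 / M) ^ i * kth_least (Suc i) (X n)\<bar> \<le> (1 / M) ^ i * C"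
        using M by (simp add: abs_mult mult_left_mono)
    qed
  qed
  obtain l where l: "k = Suc l" using k by (cases k) auto
  have "convergent (\<lambda>n. \<Phi> (Suc l) n - \<Phi> l n)"
    using k l by (intro convergent_diff \<Phi>_conv) auto
  hence "convergent (\<lambda>n. (1 / M) ^ l * kth_least k (X n))"
    by (simp add: \<Phi>_def l)
  thus "convergent (\<lambda>n. kth_least k (X n))"
    using M by (subst (asm) convergent_mult_const_iff) auto
qed

end
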